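(* Let the integers $T^\ast(n)$, $n\ge 0$, be defined by $\sum_{n\geq 0}T^\ast(n)q^n=\dfrac{f_1^5f_{10}^5}{f_2f_5}$. Then for all integers $n\geq 0$ and $\alpha\geq 1$, \[ T^\ast(5^\alpha n+5^\alpha -2)\equiv 0 \pmod{5^{\alpha}}. \]
   Context: For a positive integer $k$, $f_k:=(q^k;q^k)_\infty=\prod_{i\geq 1}(1-q^{ki})$, regarded as a formal power series in $q$ with integer coefficients (invertible, since its constant term is $1$). *)

theory Defs
  imports "HOL-Analysis.Analysis" "HOL-Number_Theory.Cong"
begin

(* The infinite product is taken with respect to the metric on formal power series, in which
   convergence means eventual stabilisation of every coefficient. The index is shifted because
   prodinf starts at 0. For k = 0 the product is degenerate; it is used only for k > 0. *)
definition euler_fps :: "nat \<Rightarrow> int fps" where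
  "euler_fps k = (\<Prod>i. 1 - fps_X ^ (k * Suc i))"

lemma
  assumes "k > 0"
  shows has_prod_euler_fps: "(\<lambda>i. 1 - fps_X ^ (k * Suc i)) has_prod euler_fps k"
    and euler_fps_nth_0: "fps_nth (euler_fps k) 0 = 1"
proof -
  define g where "g = (\<lambda>i. 1 - fps_X ^ (k * Suc i) :: int fps)"
  define c where "c = (\<lambda>n. fps_nth (\<Prod>i\<le>n. g i) n)"
  have stable: "fps_nth (\<Prod>i\<le>m. g i) n = c n" if "m \<ge> n" for m n
    using that
  proof (induction m rule: dec_induct)
    case (step m)
    have "1 * Suc (Suc m) \<le> k * Suc (Suc m)"
      using assms by (intro mult_le_mono1) linarith
    moreover have "n < 1 * Suc (Suc m)"
      using step.hyps by simp
    ultimately have "n < k * Suc (Suc m)"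
      by (rule less_le_trans [rotated])
    then have "fps_nth ((\<Prod>i\<le>m. g i) * fps_X ^ (k * Suc (Suc m))) n = 0"
      by (simp only: fps_X_power_mult_right_nth if_True)
    moreover have "(\<Prod>i\<le>Suc m. g i) = (\<Prod>i\<le>m. g i) - (\<Prod>i\<le>m. g i) * fps_X ^ (k * Suc (Suc m))"
      unfolding prod.atMost_Suc by (subst (2) g_def) (simp only: right_diff_distrib mult_1_right)
    ultimately show ?case
      using step.IH by (simp only: fps_sub_nth diff_0_right)
  qed (simp add: c_def)
  have "(\<lambda>m. \<Prod>i\<le>m. g i) \<longlonglongrightarrow> Abs_fps c"
  proof (rule tendsto_fpsI)
    fix n
    show "\<forall>\<^sub>F m in sequentially. fps_nth (\<Prod>i\<le>m. g i) n = fps_nth (Abs_fps c) n"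
      using eventually_ge_at_top[of n] by eventually_elim (simp add: stable)
  qed
  moreover have c0: "c 0 = 1"
    using assms by (simp add: c_def g_def)
  then have "Abs_fps c \<noteq> 0"
    by (auto simp: fps_eq_iff intro!: exI[of _ 0])
  ultimately have P: "g has_prod Abs_fps c"
    by (simp add: has_prod_def raw_has_prod_def)
  then have eq: "euler_fps k = Abs_fps c"
    unfolding euler_fps_def g_def by (rule has_prod_unique [symmetric])
  show "(\<lambda>i. 1 - fps_X ^ (k * Suc i)) has_prod euler_fps k"
    using P unfolding eq g_def .
  show "fps_nth (euler_fps k) 0 = 1"
    by (simp add: eq c0)
qed

(* The type int has no inverse operation, so division of int fps is unavailable; the second
   argument of fps_right_inverse is the inverse of the constant term of the first. *)
definition Tstar :: "nat \<Rightarrow> int" where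
  "Tstar n = fps_nth (euler_fps 1 ^ 5 * euler_fps 10 ^ 5 *
     fps_right_inverse (euler_fps 2 * euler_fps 5) 1) n"

lemma Tstar_generating_function:
  "Abs_fps Tstar * (euler_fps 2 * euler_fps 5) = euler_fps 1 ^ 5 * euler_fps 10 ^ 5"
proof -
  have "euler_fps 2 * euler_fps 5 * fps_right_inverse (euler_fps 2 * euler_fps 5) 1 = 1"
    by (rule fps_right_inverse) (simp add: euler_fps_nth_0)
  moreover have "Abs_fps Tstar = euler_fps 1 ^ 5 * euler_fps 10 ^ 5 *
     fps_right_inverse (euler_fps 2 * euler_fps 5) 1"
    by (rule fps_ext) (simp add: Tstar_def)
  ultimately show ?thesis
    by (simp only: mult.assoc mult.commute [of "fps_right_inverse _ _"] mult_1_right)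
qed

end

theory Submission
  imports Defs
begin

text \<open>
  Write \<open>q\<close> for the variable and \<open>f\<^sub>k\<close> for \<open>euler_fps k\<close>. The generating function factors as
  \<open>(f\<^sub>1\<^sup>5 / f\<^sub>2) (f\<^sub>1\<^sub>0\<^sup>5 / f\<^sub>5)\<close>, and both factors are theta series of binary forms, because
  \<open>f\<^sub>1\<^sup>2 / f\<^sub>2\<close> and \<open>f\<^sub>2\<^sup>2 / f\<^sub>1\<close> are the series of Gauss for the squares and for the triangular
  numbers, and \<open>f\<^sub>1\<^sup>3\<close> is the series of Jacobi with the odd weights \<open>2 t + 1\<close>:

    \<^item> \<open>2 f\<^sub>1\<^sup>5 / f\<^sub>2\<close> is the sum over integers \<open>s, t\<close> of \<open>(-1)\<^sup>s (-1)\<^sup>t (2 t + 1) q\<^sup>N\<close> with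
      \<open>8 N + 1 = 8 s\<^sup>2 + (2 t + 1)\<^sup>2\<close>;
    \<^item> \<open>4 f\<^sub>2\<^sup>5 / f\<^sub>1\<close> is the sum over integers \<open>u, v\<close> of \<open>(-1)\<^sup>v (2 v + 1) q\<^sup>N\<close> with
      \<open>8 N + 3 = (2 u + 1)\<^sup>2 + 2 (2 v + 1)\<^sup>2\<close>, and \<open>f\<^sub>1\<^sub>0\<^sup>5 / f\<^sub>5\<close> is \<open>f\<^sub>2\<^sup>5 / f\<^sub>1\<close> with \<open>q\<^sup>5\<close> for \<open>q\<close>.

  Since \<open>-2\<close> is not a square modulo 5, a form \<open>x\<^sup>2 + 2 y\<^sup>2\<close> is divisible by 5 only if \<open>x\<close> and \<open>y\<close>
  are. So in the first series the terms with \<open>N\<close> congruent to 3 modulo 5 are those in which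
  \<open>s\<close> and \<open>2 t + 1\<close> are multiples of 5. Dividing both by 5 does not change the sign, takes a factor 5
  out of the weight and turns \<open>N\<close> into \<open>(N - 3) / 25\<close>: these terms are 5 times the whole
  series with \<open>q\<^sup>2\<^sup>5\<close> for \<open>q\<close>, shifted by \<open>q\<^sup>3\<close>. The second series behaves in the same way for the class
  of 4 modulo 5, with the shift \<open>q\<^sup>9\<close>.

  Hence 8 times the generating function is a theta series over quadruples with exponent
  \<open>E + 5 F\<close>, for the exponents \<open>E\<close>, \<open>F\<close> of the two binary series. Its coefficients at \<open>5 n + 3\<close> are
  5 times those of the theta series with exponent \<open>5 E + F\<close>, and the coefficients of the latter at
  \<open>5 n + 4\<close> are 5 times those of the theta series with exponent \<open>E + 5 F + 1\<close>. The first step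
  (\<open>theta_series_coeff_3_mod_5\<close>) gives one factor 5; both steps together
  (\<open>theta_series_coeff_4_mod_5\<close>) come back to the original series and give
  \<open>Tstar (25 n + 48) = 25 Tstar n\<close>. Induction on the exponent in steps of two finishes the proof.

  The series of Gauss and Jacobi are limits of one finite identity, the triple product
  \<open>finite_triple_product\<close>.
\<close>

section \<open>Gaussian binomial coefficients and the finite triple product\<close>

text \<open>
  The numbers \<open>tri t\<close> and \<open>tri (- t)\<close> are the exponents in the theta function
  \<open>\<Sum>t. A\<^bsup>t (t + 1) / 2\<^esup> B\<^bsup>t (t - 1) / 2\<^esup>\<close> of Ramanujan. Sums with triangular exponents run over all
  integers below, so that every triangular number is met twice, at \<open>t\<close> and at \<open>- 1 - t\<close>; this is where the factors 2 in the
  theta identities come from.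
\<close>
definition tri :: "int \<Rightarrow> nat" where
  "tri t = nat (t * (t + 1) div 2)"

lemma two_tri: "2 * int (tri t) = t * (t + 1)"
proof -
  have "t * (t + 1) \<ge> 0"
    by (cases "t \<ge> 0") (auto simp: mult_nonpos_nonpos)
  moreover have "even (t * (t + 1))"
    by simp
  ultimately show ?thesis
    by (simp add: tri_def)
qed

lemma tri_uminus: "int (tri t) = int (tri (- t)) + t"
  using two_tri[of t] two_tri[of "- t"] by (simp add: algebra_simps)

lemma tri_diff_1: "int (tri (t - 1)) + t = int (tri t)"
  using two_tri[of t] two_tri[of "t - 1"] by (simp add: algebra_simps)

lemma tri_0 [simp]: "tri 0 = 0"
  by (simp add: tri_def)

lemma abs_le_tri: "\<bar>t\<bar> \<le> int (tri t) + 1"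
proof -
  have "0 \<le> t * (t + 1) - 2 * \<bar>t\<bar> + 2"
  proof (cases "t \<ge> 0")
    case True
    have "0 \<le> (t - 1) * t"
      using True by (cases "t = 0") auto
    then show ?thesis
      using True by (simp add: algebra_simps)
  next
    case False
    have "0 \<le> (- t - 1) * (- t - 2)"
      using False by (cases "t = -1") (auto intro!: mult_nonneg_nonneg)
    then show ?thesis
      using False by (simp add: algebra_simps)
  qed
  then show ?thesis
    using two_tri[of t] by linarith
qed

text \<open>
  The Pascal recursion serves as definition, because the usual quotient of \<open>q\<close>-factorials makes no
  sense in a general ring. The lemma \<open>qbinomial_qpoch\<close> recovers the quotient, cross-multiplied.
\<close>
fun qbinomial :: "'a::comm_ring_1 \<Rightarrow> nat \<Rightarrow> nat \<Rightarrow> 'a" where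
  "qbinomial q n 0 = 1"
| "qbinomial q 0 (Suc k) = 0"
| "qbinomial q (Suc n) (Suc k) = qbinomial q n k + q ^ Suc k * qbinomial q n (Suc k)"

lemma qbinomial_eq_0: "n < k \<Longrightarrow> qbinomial q n k = 0"
  by (induction q n k rule: qbinomial.induct) auto

lemma qbinomial_self: "qbinomial q n n = 1"
  by (induction n) (auto simp: qbinomial_eq_0)

text \<open>
  Pascal's rule summed against a weight \<open>F\<close>: this form reduces each induction step below to the
  comparison of two monomials.
\<close>
lemma sum_qbinomial_Suc:
  "(\<Sum>k\<le>Suc n. qbinomial q (Suc n) k * F k) =
   (\<Sum>k\<le>n. qbinomial q n k * (F (Suc k) + q ^ k * F k))"
proof -
  have "(\<Sum>k\<le>Suc n. qbinomial q (Suc n) k * F k) =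
      F 0 + (\<Sum>k\<le>n. qbinomial q n k * F (Suc k))
        + (\<Sum>k\<le>n. qbinomial q n (Suc k) * (q ^ Suc k * F (Suc k)))"
    by (simp add: sum.atMost_Suc_shift sum.distrib algebra_simps del: sum.atMost_Suc)
  also have "F 0 + (\<Sum>k\<le>n. qbinomial q n k * F (Suc k))
        + (\<Sum>k\<le>n. qbinomial q n (Suc k) * (q ^ Suc k * F (Suc k))) =
      (\<Sum>k\<le>n. qbinomial q n k * F (Suc k)) + (\<Sum>k\<le>Suc n. qbinomial q n k * (q ^ k * F k))"
    by (simp add: sum.atMost_Suc_shift del: sum.atMost_Suc)
  also have "\<dots> = (\<Sum>k\<le>n. qbinomial q n k * (F (Suc k) + q ^ k * F k))"
    by (simp add: qbinomial_eq_0 sum.distrib algebra_simps)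
  finally show ?thesis .
qed

lemma q_binomial_theorem:
  "(\<Prod>i<a. 1 + x * q ^ i) = (\<Sum>k\<le>a. qbinomial q a k * (x ^ k * q ^ tri (- int k)))"
proof (induction a arbitrary: x)
  case (Suc a)
  have tri: "tri (- int (Suc k)) = k + tri (- int k)" for k
  proof -
    have "- int (Suc k) = - int k - 1"
      by simp
    then have "tri (- int (Suc k)) = tri (- int k - 1)"
      by (rule arg_cong)
    then show ?thesis
      using tri_diff_1[of "- int k"] by linarith
  qed
  have "(\<Prod>i<Suc a. 1 + x * q ^ i) = (1 + x) * (\<Prod>i<a. 1 + (x * q) * q ^ i)"
    by (simp add: prod.lessThan_Suc_shift mult.assoc del: prod.lessThan_Suc)
  also have "\<dots> = (\<Sum>k\<le>a. qbinomial q a k *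
      (x ^ Suc k * q ^ tri (- int (Suc k)) + q ^ k * (x ^ k * q ^ tri (- int k))))"
    unfolding Suc.IH tri by (simp add: sum_distrib_left power_add power_mult_distrib algebra_simps)
  also have "\<dots> = (\<Sum>k\<le>Suc a. qbinomial q (Suc a) k * (x ^ k * q ^ tri (- int k)))"
    by (rule sum_qbinomial_Suc [symmetric])
  finally show ?case .
qed simp

text \<open>
  The truncated Jacobi triple product in the symmetric form of Ramanujan, with base \<open>A B\<close>. For
  \<open>b = 0\<close> it is the \<open>q\<close>-binomial theorem, and each further factor \<open>1 + B (A B)\<^sup>b\<close> is absorbed by
  Pascal's rule. No convergence is involved, so \<open>A\<close> and \<open>B\<close> may lie in any commutative ring; the proof
  of Jacobi's identity takes them in a ring of power series in a further variable.
\<close>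
theorem finite_triple_product:
  fixes A B :: "'a::comm_ring_1"
  shows "(\<Prod>i<a. 1 + A * (A * B) ^ i) * (\<Prod>i<b. 1 + B * (A * B) ^ i) =
    (\<Sum>k\<le>a + b. qbinomial (A * B) (a + b) k *
       (A ^ tri (int k - int b) * B ^ tri (int b - int k)))"
proof (induction b)
  case 0
  have "A ^ k * (A * B) ^ tri (- int k) = A ^ tri (int k) * B ^ tri (- int k)" for k
  proof -
    have "tri (int k) = k + tri (- int k)"
      using tri_uminus[of "int k"] by linarith
    then show ?thesis
      by (simp only: power_add power_mult_distrib mult.assoc)
  qed
  then show ?case
    using q_binomial_theorem[of A "A * B" a] by simp
next
  case (Suc b)
  define F where "F k = A ^ tri (int k - int (Suc b)) * B ^ tri (int (Suc b) - int k)" for k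
  have step: "F (Suc k) + (A * B) ^ k * F k =
      (1 + B * (A * B) ^ b) * (A ^ tri (int k - int b) * B ^ tri (int b - int k))" for k
  proof -
    have "k + tri (int k - int (Suc b)) = b + tri (int k - int b)"
      using tri_diff_1[of "int k - int b"] by (simp add: algebra_simps)
    moreover have "k + tri (int (Suc b) - int k) = Suc b + tri (int b - int k)"
      using tri_diff_1[of "int (Suc b) - int k"] by (simp add: algebra_simps)
    ultimately have "A ^ k * A ^ tri (int k - int (Suc b)) = A ^ b * A ^ tri (int k - int b)"
      "B ^ k * B ^ tri (int (Suc b) - int k) = B ^ Suc b * B ^ tri (int b - int k)"
      by (simp_all only: power_add [symmetric])
    then have "(A ^ k * A ^ tri (int k - int (Suc b))) * (B ^ k * B ^ tri (int (Suc b) - int k))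
       = (A ^ b * A ^ tri (int k - int b)) * (B ^ Suc b * B ^ tri (int b - int k))"
      by simp
    then show ?thesis
      by (simp add: F_def power_mult_distrib algebra_simps)
  qed
  have "(\<Sum>k\<le>a + Suc b. qbinomial (A * B) (a + Suc b) k * F k) =
      (\<Sum>k\<le>a + b. qbinomial (A * B) (a + b) k * (F (Suc k) + (A * B) ^ k * F k))"
    using sum_qbinomial_Suc[of "A * B" "a + b" F] by simp
  also have "\<dots> = (1 + B * (A * B) ^ b) *
      (\<Sum>k\<le>a + b. qbinomial (A * B) (a + b) k *
         (A ^ tri (int k - int b) * B ^ tri (int b - int k)))"
    unfolding step by (simp add: sum_distrib_left algebra_simps)
  also have "\<dots> = (\<Prod>i<a. 1 + A * (A * B) ^ i) * (\<Prod>i<Suc b. 1 + B * (A * B) ^ i)"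
    unfolding Suc.IH [symmetric] by (simp add: algebra_simps)
  finally show ?case
    by (simp add: F_def)
qed

definition qpoch :: "'a::comm_ring_1 \<Rightarrow> nat \<Rightarrow> 'a" where
  "qpoch q n = (\<Prod>i<n. 1 - q ^ Suc i)"

lemma qpoch_0 [simp]: "qpoch q 0 = 1"
  and qpoch_Suc: "qpoch q (Suc n) = qpoch q n * (1 - q ^ Suc n)"
  by (simp_all add: qpoch_def)

lemma qbinomial_qpoch: "qbinomial q (k + l) k * (qpoch q k * qpoch q l) = qpoch q (k + l)"
proof (induction "k + l" arbitrary: k l)
  case (Suc n)
  show ?case
  proof (cases "k = 0 \<or> l = 0")
    case True
    then show ?thesis
      by (auto simp: qbinomial_self)
  next
    case False
    then obtain k' l' where kl: "k = Suc k'" "l = Suc l'"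
      by (meson not0_implies_Suc)
    have 1: "qbinomial q (k' + Suc l') k' * (qpoch q k' * qpoch q (Suc l')) = qpoch q (k' + Suc l')"
      using Suc.hyps(2) kl by (intro Suc.hyps(1)) simp
    have 2: "qbinomial q (Suc k' + l') (Suc k') * (qpoch q (Suc k') * qpoch q l') = qpoch q (Suc k' + l')"
      using Suc.hyps(2) kl by (intro Suc.hyps(1)) simp
    have "qbinomial q (k + l) k * (qpoch q k * qpoch q l) =
        (1 - q ^ Suc k') * (qbinomial q (k' + Suc l') k' * (qpoch q k' * qpoch q (Suc l')))
        + q ^ Suc k' * (1 - q ^ Suc l')
          * (qbinomial q (Suc k' + l') (Suc k') * (qpoch q (Suc k') * qpoch q l'))"
      by (simp add: kl qpoch_Suc algebra_simps)
    also have "\<dots> = (1 - q ^ Suc k' * q ^ Suc l') * qpoch q (k' + Suc l')"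
      unfolding 1 2 by (simp add: algebra_simps)
    also have "\<dots> = qpoch q (k + l)"
      by (simp add: kl qpoch_Suc power_add algebra_simps)
    finally show ?thesis .
  qed
qed simp

section \<open>Limits of formal power series\<close>

lemma fps_nth_mult_cong:
  assumes "\<And>i. i \<le> n \<Longrightarrow> fps_nth f i = fps_nth f' i"
    and "\<And>i. i \<le> n \<Longrightarrow> fps_nth g i = fps_nth g' i"
  shows "fps_nth (f * g) n = fps_nth (f' * g') n"
  using assms by (simp add: fps_mult_nth)

lemma eventually_fps_nth_eq_upto:
  fixes g :: "'a::group_add fps"
  assumes "(f \<longlongrightarrow> g) F"
  shows "\<forall>\<^sub>F x in F. \<forall>i\<in>{..n}. fps_nth (f x) i = fps_nth g i"
  using assms by (subst eventually_ball_finite_distrib) (auto simp: tendsto_fps_iff)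

lemma tendsto_mult_fps:
  fixes f g :: "'b \<Rightarrow> 'a::ring fps"
  assumes "(f \<longlongrightarrow> a) F" "(g \<longlongrightarrow> b) F"
  shows "((\<lambda>x. f x * g x) \<longlongrightarrow> a * b) F"
proof (rule tendsto_fpsI)
  fix n
  show "\<forall>\<^sub>F x in F. fps_nth (f x * g x) n = fps_nth (a * b) n"
    using eventually_fps_nth_eq_upto[OF assms(1), of n] eventually_fps_nth_eq_upto[OF assms(2), of n]
    by eventually_elim (rule fps_nth_mult_cong; simp)
qed

lemma tendsto_add_fps:
  fixes f g :: "'b \<Rightarrow> 'a::ring fps"
  assumes "(f \<longlongrightarrow> a) F" "(g \<longlongrightarrow> b) F"
  shows "((\<lambda>x. f x + g x) \<longlongrightarrow> a + b) F"
proof (rule tendsto_fpsI)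
  fix n
  show "\<forall>\<^sub>F x in F. fps_nth (f x + g x) n = fps_nth (a + b) n"
    using eventually_fps_nth_eq_upto[OF assms(1), of n] eventually_fps_nth_eq_upto[OF assms(2), of n]
    by eventually_elim simp
qed

lemma tendsto_sum_fps:
  fixes f :: "'i \<Rightarrow> 'b \<Rightarrow> 'a::ring fps"
  assumes "\<And>i. i \<in> I \<Longrightarrow> (f i \<longlongrightarrow> a i) F"
  shows "((\<lambda>x. \<Sum>i\<in>I. f i x) \<longlongrightarrow> (\<Sum>i\<in>I. a i)) F"
  using assms by (induction I rule: infinite_finite_induct) (auto intro: tendsto_add_fps)

text \<open>
  A limit can be divided by a convergent factor whose limit is a unit; that \<open>f\<close> converges is part of
  the conclusion. It holds because the coefficients of \<open>f\<close> up to degree \<open>n\<close> are determined by those of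
  \<open>f x * b\<close> up to degree \<open>n\<close>.
\<close>
lemma tendsto_divide_fps:
  fixes f w :: "'b \<Rightarrow> 'a::comm_ring_1 fps"
  assumes fw: "((\<lambda>x. f x * w x) \<longlongrightarrow> a) F" and w: "(w \<longlongrightarrow> b) F" and unit: "b * c = 1"
  shows "(f \<longlongrightarrow> a * c) F"
proof (rule tendsto_fpsI)
  fix n
  show "\<forall>\<^sub>F x in F. fps_nth (f x) n = fps_nth (a * c) n"
    using eventually_fps_nth_eq_upto[OF fw, of n] eventually_fps_nth_eq_upto[OF w, of n]
  proof eventually_elim
    case (elim x)
    have "fps_nth (f x * b * c) n = fps_nth (a * c) n"
    proof (rule fps_nth_mult_cong)
      fix i assume i: "i \<le> n"
      have "fps_nth (f x * b) i = fps_nth (f x * w x) i"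
        by (rule fps_nth_mult_cong) (use elim i in auto)
      then show "fps_nth (f x * b) i = fps_nth a i"
        using elim i by simp
    qed simp
    then show ?case
      by (simp add: mult.assoc unit)
  qed
qed

section \<open>Theta series\<close>

text \<open>
  The series \<open>\<Sum>i. c i * q\<^bsup>e i\<^esup>\<close> over an arbitrary index type. It has this meaning when every exponent is
  attained only finitely often; at an exponent attained infinitely often the coefficient is 0 by
  the convention for infinite sums.
\<close>
definition theta_series :: "('i \<Rightarrow> int) \<Rightarrow> ('i \<Rightarrow> nat) \<Rightarrow> int fps" where
  "theta_series c e = Abs_fps (\<lambda>n. \<Sum>i | e i = n. c i)"

lemma tendsto_qpoch_euler:
  assumes "k > 0"
  shows "(\<lambda>n. qpoch (fps_X ^ k) n) \<longlonglongrightarrow> euler_fps k"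
proof -
  have "(\<lambda>n. \<Prod>i<n. 1 - fps_X ^ (k * Suc i)) \<longlonglongrightarrow> euler_fps k"
    using has_prod_euler_fps[OF assms] by (rule has_prod_imp_tendsto')
  then show ?thesis
    unfolding qpoch_def power_mult .
qed

lemma tendsto_qpoch_euler_shift:
  assumes "k > 0" and "filterlim h at_top sequentially"
  shows "(\<lambda>n. qpoch (fps_X ^ k) (h n)) \<longlonglongrightarrow> euler_fps k"
proof -
  have "((\<lambda>n. qpoch (fps_X ^ k) n) \<circ> h) \<longlonglongrightarrow> euler_fps k"
    unfolding comp_def using tendsto_qpoch_euler[OF assms(1)] assms(2) by (rule filterlim_compose)
  then show ?thesis
    by (simp only: comp_def)
qed

lemma euler_fps_unit:
  assumes "k > 0"
  obtains g where "euler_fps k * g = 1"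
  using fps_right_inverse[of "euler_fps k" 1] euler_fps_nth_0[OF assms] by auto

lemma euler_fps_nonzero: "k > 0 \<Longrightarrow> euler_fps k \<noteq> 0"
  using euler_fps_nth_0[of k] by auto

text \<open>
  By \<open>qbinomial_qpoch\<close> the product of the coefficient with two partial products, both tending to
  \<open>f\<^sub>k\<close>, is a partial product tending to \<open>f\<^sub>k\<close>. Hence the coefficient tends to \<open>1 / f\<^sub>k\<close>, whatever the
  fixed offset \<open>t\<close> from the centre.
\<close>
lemma tendsto_central_qbinomial:
  assumes k: "k > 0" and g: "euler_fps k * g = 1"
  shows "(\<lambda>n. qbinomial (fps_X ^ k) (n + n) (nat (int n + t))) \<longlonglongrightarrow> g"
proof -
  let ?q = "fps_X ^ k :: int fps"
  define w where "w n = qpoch ?q (nat (int n + t)) * qpoch ?q (nat (int n - t))" for n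
  have lim: "filterlim (\<lambda>n. nat (int n + s)) at_top sequentially" for s
    unfolding filterlim_at_top
  proof
    fix Z
    show "\<forall>\<^sub>F n in sequentially. Z \<le> nat (int n + s)"
      using eventually_ge_at_top[of "Z + nat \<bar>s\<bar>"] by eventually_elim linarith
  qed
  have "filterlim (\<lambda>n. nat (int n - t)) at_top sequentially"
    using lim[of "- t"] by simp
  from tendsto_mult_fps[OF tendsto_qpoch_euler_shift[OF k lim[of t]] tendsto_qpoch_euler_shift[OF k this]]
  have w: "w \<longlonglongrightarrow> euler_fps k * euler_fps k"
    unfolding w_def .
  have lim2: "filterlim (\<lambda>n::nat. n + n) at_top sequentially"
    unfolding filterlim_at_top
  proof
    fix Z
    show "\<forall>\<^sub>F n in sequentially. Z \<le> n + n"
      using eventually_ge_at_top[of "Z"] by eventually_elim linarith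
  qed
  have "\<forall>\<^sub>F n in sequentially. qpoch ?q (n + n) = qbinomial ?q (n + n) (nat (int n + t)) * w n"
    using eventually_ge_at_top[of "nat \<bar>t\<bar>"]
  proof eventually_elim
    case (elim n)
    then have "n + n = nat (int n + t) + nat (int n - t)"
      by linarith
    then show ?case
      using qbinomial_qpoch[of ?q "nat (int n + t)" "nat (int n - t)"] by (simp add: w_def)
  qed
  with tendsto_qpoch_euler_shift[OF k lim2]
  have "(\<lambda>n. qbinomial ?q (n + n) (nat (int n + t)) * w n) \<longlonglongrightarrow> euler_fps k"
    by (rule Lim_transform_eventually)
  moreover have "(euler_fps k * euler_fps k) * (g * g) = (euler_fps k * g) * (euler_fps k * g)"
    by (simp only: ac_simps)
  ultimately have "(\<lambda>n. qbinomial ?q (n + n) (nat (int n + t))) \<longlonglongrightarrow> euler_fps k * (g * g)"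
    using w by (intro tendsto_divide_fps) (simp_all add: g)
  moreover have "euler_fps k * (g * g) = g"
    by (simp add: g mult.assoc [symmetric])
  ultimately show ?thesis
    by (simp only:)
qed

text \<open>
  The passage to the limit on the right of the finite triple product. It is legitimate to take
  the limit term by term: a fixed coefficient \<open>N\<close> is affected only by the terms with
  \<open>\<bar>t\<bar> \<le> N + 1\<close>, by the growth of the exponents, and each of these finitely many terms converges by
  \<open>tendsto_central_qbinomial\<close>.
\<close>
lemma tendsto_theta_series:
  fixes c :: "int \<Rightarrow> int"
  assumes k: "k > 0" and growth: "\<And>t. \<bar>t\<bar> \<le> int (e t) + 1"
  shows "(\<lambda>n. euler_fps k * (\<Sum>j\<le>n + n. qbinomial (fps_X ^ k) (n + n) j *
           (fps_const (c (int j - int n)) * fps_X ^ e (int j - int n))))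
         \<longlonglongrightarrow> theta_series c e"
proof (rule tendsto_fpsI)
  fix N
  define b where "b n t = qbinomial (fps_X ^ k :: int fps) (n + n) (nat (int n + t))" for n t
  define f where "f t = fps_const (c t) * fps_X ^ e t" for t
  define T where "T = {- int (N + 1) .. int (N + 1)}"
  obtain g where g: "euler_fps k * g = 1"
    using euler_fps_unit[OF k] by blast
  have "(\<lambda>n. euler_fps k * (\<Sum>t\<in>T. b n t * f t)) \<longlonglongrightarrow> euler_fps k * (\<Sum>t\<in>T. g * f t)"
    unfolding b_def
    by (intro tendsto_mult_fps tendsto_sum_fps tendsto_const tendsto_central_qbinomial[OF k g])
  also have "euler_fps k * (\<Sum>t\<in>T. g * f t) = (\<Sum>t\<in>T. f t)"
    by (simp add: sum_distrib_left [symmetric] mult.assoc [symmetric] g)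
  finally have lim: "\<forall>\<^sub>F n in sequentially.
      fps_nth (euler_fps k * (\<Sum>t\<in>T. b n t * f t)) N = fps_nth (\<Sum>t\<in>T. f t) N"
    by (simp add: tendsto_fps_iff)
  have coeff: "fps_nth (\<Sum>t\<in>T. f t) N = fps_nth (theta_series c e) N"
  proof -
    have "{t. e t = N} \<subseteq> T"
    proof
      fix t assume "t \<in> {t. e t = N}"
      then show "t \<in> T"
        using growth[of t] by (auto simp: T_def)
    qed
    have "fps_nth (\<Sum>t\<in>T. f t) N = (\<Sum>t\<in>T. if e t = N then c t else 0)"
      by (auto simp: fps_sum_nth f_def fps_X_power_iff intro!: sum.cong)
    also have "\<dots> = (\<Sum>t\<in>{t. e t = N}. c t)"
      using \<open>{t. e t = N} \<subseteq> T\<close>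
      by (intro sum.mono_neutral_cong_right) (auto simp: T_def)
    finally show ?thesis
      by (simp add: theta_series_def)
  qed
  have "fps_nth (euler_fps k * (\<Sum>j\<le>n + n. qbinomial (fps_X ^ k) (n + n) j *
           f (int j - int n))) N = fps_nth (euler_fps k * (\<Sum>t\<in>T. b n t * f t)) N"
    if n: "n \<ge> N + 1" for n
  proof (rule fps_nth_mult_cong)
    fix i assume i: "i \<le> N"
    have "(\<Sum>j\<le>n + n. qbinomial (fps_X ^ k) (n + n) j * f (int j - int n)) =
        (\<Sum>t\<in>{- int n..int n}. b n t * f t)"
      by (rule sum.reindex_bij_witness[of _ "\<lambda>t. nat (int n + t)" "\<lambda>j. int j - int n"])
         (auto simp: b_def)
    also have "fps_nth \<dots> i = (\<Sum>t\<in>{- int n..int n}. fps_nth (b n t * f t) i)"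
      by (simp add: fps_sum_nth)
    also have "\<dots> = (\<Sum>t\<in>T. fps_nth (b n t * f t) i)"
    proof (rule sum.mono_neutral_right)
      show "\<forall>t\<in>{- int n..int n} - T. fps_nth (b n t * f t) i = 0"
      proof
        fix t assume "t \<in> {- int n..int n} - T"
        then have "i < e t"
          using growth[of t] i by (auto simp: T_def)
        moreover have "b n t * f t = (b n t * fps_const (c t)) * fps_X ^ e t"
          by (simp add: f_def mult.assoc)
        ultimately show "fps_nth (b n t * f t) i = 0"
          by (simp only: fps_X_power_mult_right_nth if_True)
      qed
    qed (use n in \<open>auto simp: T_def\<close>)
    finally show "fps_nth (\<Sum>j\<le>n + n. qbinomial (fps_X ^ k) (n + n) j * f (int j - int n)) i =
        fps_nth (\<Sum>t\<in>T. b n t * f t) i"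
      by (simp add: fps_sum_nth)
  qed simp
  then have "\<forall>\<^sub>F n in sequentially. fps_nth (euler_fps k * (\<Sum>j\<le>n + n. qbinomial (fps_X ^ k) (n + n) j *
           f (int j - int n))) N = fps_nth (euler_fps k * (\<Sum>t\<in>T. b n t * f t)) N"
    unfolding eventually_sequentially by blast
  with lim show "\<forall>\<^sub>F n in sequentially. fps_nth (euler_fps k * (\<Sum>j\<le>n + n.
      qbinomial (fps_X ^ k) (n + n) j *
        (fps_const (c (int j - int n)) * fps_X ^ e (int j - int n)))) N = fps_nth (theta_series c e) N"
    unfolding f_def [symmetric] coeff [symmetric] by eventually_elim simp
qed

lemma finite_fibre_sum:
  fixes e :: "'i \<Rightarrow> nat" and e' :: "'j \<Rightarrow> nat"
  shows "{(i, j). e i + e' j = n} = (\<Union>k\<in>{0..n}. {i. e i = k} \<times> {j. e' j = n - k})"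
proof (intro equalityI subsetI)
  fix p assume "p \<in> {(i, j). e i + e' j = n}"
  then show "p \<in> (\<Union>k\<in>{0..n}. {i. e i = k} \<times> {j. e' j = n - k})"
    by (auto intro!: bexI[of _ "e (fst p)"])
qed auto

lemma theta_series_mult:
  fixes e :: "'i \<Rightarrow> nat" and e' :: "'j \<Rightarrow> nat"
  assumes "\<And>n. finite {i. e i = n}" "\<And>n. finite {j. e' j = n}"
  shows "theta_series c e * theta_series c' e' =
    theta_series (\<lambda>(i, j). c i * c' j) (\<lambda>(i, j). e i + e' j)"
proof (rule fps_ext)
  fix n
  have "fps_nth (theta_series (\<lambda>(i, j). c i * c' j) (\<lambda>(i, j). e i + e' j)) n =
      (\<Sum>(i, j) | e i + e' j = n. c i * c' j)"
    by (auto simp: theta_series_def intro!: sum.cong)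
  also have "\<dots> = (\<Sum>k\<in>{0..n}. \<Sum>(i, j)\<in>{i. e i = k} \<times> {j. e' j = n - k}. c i * c' j)"
    unfolding finite_fibre_sum by (rule sum.UNION_disjoint) (use assms in auto)
  also have "\<dots> = fps_nth (theta_series c e * theta_series c' e') n"
    by (simp add: fps_mult_nth theta_series_def sum_product sum.cartesian_product)
  finally show "fps_nth (theta_series c e * theta_series c' e') n =
      fps_nth (theta_series (\<lambda>(i, j). c i * c' j) (\<lambda>(i, j). e i + e' j)) n" ..
qed

lemma finite_fibre_pair:
  fixes e :: "'i \<Rightarrow> nat" and e' :: "'j \<Rightarrow> nat"
  assumes "\<And>n. finite {i. e i = n}" "\<And>n. finite {j. e' j = n}"
  shows "finite {p. (case p of (i, j) \<Rightarrow> e i + e' j) = n}"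
proof -
  have "{p. (case p of (i, j) \<Rightarrow> e i + e' j) = n} = {(i, j). e i + e' j = n}"
    by auto
  then show ?thesis
    using assms by (simp only: finite_fibre_sum) auto
qed

lemma finite_fibre_growth:
  assumes "\<And>t. \<bar>t\<bar> \<le> int (e t) + 1"
  shows "finite {t. e t = n}"
proof (rule finite_subset)
  show "{t. e t = n} \<subseteq> {- int n - 1..int n + 1}"
  proof
    fix t assume "t \<in> {t. e t = n}"
    then show "t \<in> {- int n - 1..int n + 1}"
      using assms[of t] by auto
  qed
qed simp

text \<open>
  The coefficients in a residue class are governed by the indices with exponent in that class. If
  a reparametrisation \<open>g\<close> hits exactly those indices and multiplies the weights by \<open>d\<close>, then the
  coefficients in that class form \<open>d\<close> times another theta series.
\<close>
lemma theta_series_dissection: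
  assumes "inj g"
    and "\<And>i. e i mod m = r \<Longrightarrow> i \<in> range g"
    and "\<And>i. e (g i) = m * e' i + r"
    and "\<And>i. c (g i) = d * c' i"
    and "r < m"
  shows "fps_nth (theta_series c e) (m * n + r) = d * fps_nth (theta_series c' e') n"
proof -
  have "{i. e i = m * n + r} = g ` {i. e' i = n}"
  proof (intro equalityI subsetI)
    fix i assume i: "i \<in> {i. e i = m * n + r}"
    then obtain j where "i = g j"
      using assms(2)[of i] \<open>r < m\<close> by auto
    then show "i \<in> g ` {i. e' i = n}"
      using i assms(3)[of j] \<open>r < m\<close> by auto
  qed (use assms(3) in auto)
  moreover have "inj_on g {i. e' i = n}"
    using assms(1) by (rule inj_on_subset) simp
  ultimately show ?thesis
    by (simp add: theta_series_def sum.reindex assms(4) sum_distrib_left)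
qed

section \<open>The theta series of Gauss and Jacobi\<close>

lemma qpoch_double: "qpoch q (n + n) = qpoch (q\<^sup>2) n * (\<Prod>i<n. 1 - q * (q\<^sup>2) ^ i)"
proof (induction n)
  case (Suc n)
  have "q ^ Suc (n + n) = q * (q\<^sup>2) ^ n" "q ^ Suc (Suc (n + n)) = (q\<^sup>2) ^ Suc n"
    by (simp_all add: power_add power_mult_distrib power2_eq_square)
  then have "qpoch q (Suc n + Suc n) = qpoch q (n + n) * (1 - q * (q\<^sup>2) ^ n) * (1 - (q\<^sup>2) ^ Suc n)"
    by (simp only: add_Suc add_Suc_right qpoch_Suc)
  then show ?case
    unfolding Suc.IH by (simp add: qpoch_Suc mult.assoc mult.left_commute)
qed simp

lemma qpoch_square:
  fixes q :: "'a::comm_ring_1"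
  shows "(\<Prod>i<n. 1 + q ^ Suc i) * qpoch q n = qpoch (q\<^sup>2) n"
proof (induction n)
  case (Suc n)
  have "(1 + x) * (1 - x) = 1 - x\<^sup>2" for x :: 'a
    by (simp add: power2_eq_square algebra_simps)
  moreover have "(q\<^sup>2) ^ Suc n = (q ^ Suc n)\<^sup>2"
    by (simp only: power_mult [symmetric] mult.commute)
  ultimately have eq: "(1 + q ^ Suc n) * (1 - q ^ Suc n) = 1 - (q\<^sup>2) ^ Suc n"
    by (simp only:)
  have "(\<Prod>i<Suc n. 1 + q ^ Suc i) * qpoch q (Suc n) =
      ((\<Prod>i<n. 1 + q ^ Suc i) * qpoch q n) * ((1 + q ^ Suc n) * (1 - q ^ Suc n))"
    by (simp only: prod.lessThan_Suc qpoch_Suc ac_simps)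
  then show ?case
    by (simp only: eq Suc.IH qpoch_Suc)
qed simp

definition alt_sign :: "int \<Rightarrow> int" where
  "alt_sign t = (if even t then 1 else - 1)"

definition jacobi_weight :: "int \<Rightarrow> int" where
  "jacobi_weight t = (2 * t + 1) * alt_sign t"

lemma tri_add_tri_uminus: "tri t + tri (- t) = nat (t\<^sup>2)"
  using two_tri[of t] two_tri[of "- t"] by (simp add: power2_eq_square algebra_simps)

lemma alt_sign_power: "(- 1) ^ nat (t\<^sup>2) = alt_sign t"
  by (simp add: alt_sign_def minus_one_power_iff even_nat_iff)

lemma abs_le_square: "\<bar>t\<bar> \<le> int (nat (t\<^sup>2)) + (1::int)"
proof -
  have "0 \<le> \<bar>t\<bar> * (\<bar>t\<bar> - 1)"
    by (cases "t = 0") simp_all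
  then show ?thesis
    by (simp add: power2_eq_square right_diff_distrib)
qed

lemma growth_scale:
  assumes "\<bar>t\<bar> \<le> int (e t) + 1" "k > 0"
  shows "\<bar>t\<bar> \<le> int (k * e t) + 1"
proof -
  have "e t \<le> k * e t"
    using assms(2) by simp
  then show ?thesis
    using assms(1) by linarith
qed

text \<open>
  The triple product with \<open>A = B = - q\<^sup>k\<close> and base \<open>q\<^bsup>2 k\<^esup>\<close> has the square of
  \<open>(1 - q\<^sup>k) (1 - q\<^bsup>3 k\<^esup>) (1 - q\<^bsup>5 k\<^esup>) \<dots>\<close> on the left, which is \<open>(f\<^sub>k / f\<^bsub>2 k\<^esub>)\<^sup>2\<close>. Multiplying the
  finite identity by the square of a partial product of \<open>f\<^bsub>2 k\<^esub>\<close> completes the odd factors to a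
  partial product of \<open>f\<^sub>k\<close>, so that only limits of partial products of \<open>f\<^sub>k\<close> and \<open>f\<^bsub>2 k\<^esub>\<close> occur.
\<close>
theorem gauss_square_series:
  assumes k: "k > 0"
  shows "euler_fps k ^ 2 = euler_fps (2 * k) * theta_series alt_sign (\<lambda>s. k * nat (s\<^sup>2))"
proof -
  let ?q = "fps_X ^ k :: int fps" and ?Q = "fps_X ^ (2 * k) :: int fps"
  let ?\<theta> = "theta_series alt_sign (\<lambda>s. k * nat (s\<^sup>2))"
  have Q: "?Q = ?q\<^sup>2"
    by (simp only: power_mult [symmetric] mult.commute)
  then have Q': "(- ?q) * (- ?q) = ?Q"
    by (simp only: power2_eq_square minus_mult_minus)
  define S where "S n = (\<Sum>j\<le>n + n. qbinomial ?Q (n + n) j *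
      (fps_const (alt_sign (int j - int n)) * fps_X ^ (k * nat ((int j - int n)\<^sup>2))))" for n
  have monomial: "(- ?q) ^ tri t * (- ?q) ^ tri (- t) = fps_const (alt_sign t) * fps_X ^ (k * nat (t\<^sup>2))" for t
  proof -
    have "(- ?q) ^ tri t * (- ?q) ^ tri (- t) = (- 1 * ?q) ^ nat (t\<^sup>2)"
      by (simp add: power_add [symmetric] tri_add_tri_uminus)
    also have "\<dots> = (- 1) ^ nat (t\<^sup>2) * fps_X ^ (k * nat (t\<^sup>2))"
      by (simp only: power_mult_distrib power_mult)
    also have "(- 1 :: int fps) ^ nat (t\<^sup>2) = fps_const ((- 1) ^ nat (t\<^sup>2))"
      by (simp only: fps_const_power [symmetric] fps_const_neg [symmetric] fps_const_1_eq_1)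
    finally show ?thesis
      by (simp only: alt_sign_power)
  qed
  have S: "S n = (\<Prod>i<n. 1 - ?q * ?Q ^ i)\<^sup>2" for n
  proof -
    have "(\<Prod>i<n. 1 + (- ?q) * ?Q ^ i) * (\<Prod>i<n. 1 + (- ?q) * ?Q ^ i) = S n"
      using finite_triple_product[where A = "- ?q" and B = "- ?q" and a = n and b = n]
      unfolding Q' S_def monomial [symmetric]
      by (simp only: minus_diff_eq)
    then show ?thesis
      by (simp only: power2_eq_square mult_minus_left add_uminus_conv_diff)
  qed
  have dbl: "filterlim (\<lambda>n::nat. n + n) at_top sequentially"
    by (rule filterlim_at_top_mono[OF filterlim_ident]) simp
  have k2: "2 * k > 0"
    using k by simp
  have S_lim: "(\<lambda>n. euler_fps (2 * k) * S n) \<longlonglongrightarrow> ?\<theta>"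
    unfolding S_def
    by (rule tendsto_theta_series[where c = alt_sign and e = "\<lambda>s. k * nat (s\<^sup>2)", OF k2])
       (rule growth_scale[where e = "\<lambda>s. nat (s\<^sup>2)", OF abs_le_square k])
  have lim1: "(\<lambda>n. (euler_fps (2 * k) * S n) * (qpoch ?Q n * qpoch ?Q n)) \<longlonglongrightarrow>
      ?\<theta> * (euler_fps (2 * k) * euler_fps (2 * k))"
    by (intro tendsto_mult_fps S_lim tendsto_qpoch_euler k2)
  have eq: "(euler_fps (2 * k) * S n) * (qpoch ?Q n * qpoch ?Q n) =
      euler_fps (2 * k) * (qpoch ?q (n + n) * qpoch ?q (n + n))" for n
    unfolding qpoch_double[of ?q] S Q by (simp only: power2_eq_square ac_simps)
  have lim2: "(\<lambda>n. euler_fps (2 * k) * (qpoch ?q (n + n) * qpoch ?q (n + n))) \<longlonglongrightarrow>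
      euler_fps (2 * k) * (euler_fps k * euler_fps k)"
    by (intro tendsto_mult_fps tendsto_const tendsto_qpoch_euler_shift[OF k dbl])
  have "?\<theta> * (euler_fps (2 * k) * euler_fps (2 * k)) =
      euler_fps (2 * k) * (euler_fps k * euler_fps k)"
    using lim1 lim2 unfolding eq by (rule LIMSEQ_unique)
  then have "euler_fps (2 * k) * euler_fps k ^ 2 = euler_fps (2 * k) * (euler_fps (2 * k) * ?\<theta>)"
    by (simp only: power2_eq_square ac_simps)
  then show ?thesis
    using euler_fps_nonzero[of "2 * k"] k by simp
qed

text \<open>
  The triple product with \<open>A = q\<^sup>k\<close>, \<open>B = 1\<close> and base \<open>q\<^sup>k\<close>: its factors are \<open>1 + q\<^bsup>k i\<^esup>\<close>, twice for
  every \<open>i > 0\<close> and once for \<open>i = 0\<close>. The latter is the factor 2, and the product over \<open>i > 0\<close> is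
  \<open>f\<^bsub>2 k\<^esub> / f\<^sub>k\<close>.
\<close>
theorem gauss_triangular_series:
  assumes k: "k > 0"
  shows "2 * euler_fps (2 * k) ^ 2 = euler_fps k * theta_series (\<lambda>_. 1) (\<lambda>t. k * tri t)"
proof -
  let ?q = "fps_X ^ k :: int fps" and ?Q = "fps_X ^ (2 * k) :: int fps"
  let ?\<theta> = "theta_series (\<lambda>_. 1) (\<lambda>t. k * tri t)"
  have Q: "?Q = ?q\<^sup>2"
    by (simp only: power_mult [symmetric] mult.commute)
  have k2: "2 * k > 0"
    using k by simp
  define R where "R n = (\<Prod>i<n. 1 + ?q ^ Suc i)" for n
  define S where "S n = (\<Sum>j\<le>n + n. qbinomial ?q (n + n) j *
      (fps_const 1 * fps_X ^ (k * tri (int j - int n))))" for n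
  have S: "S (Suc n) = 2 * R (Suc n) * R n" for n
  proof -
    have "(\<Prod>i<Suc n. 1 + ?q * ?q ^ i) * (\<Prod>i<Suc n. 1 + 1 * ?q ^ i) = S (Suc n)"
      using finite_triple_product[where A = ?q and B = 1 and a = "Suc n" and b = "Suc n"]
      by (simp only: S_def mult_1_right mult_1_left power_one fps_const_1_eq_1 power_mult)
    moreover have "(\<Prod>i<Suc n. 1 + 1 * ?q ^ i) = 2 * R n"
      by (simp add: prod.lessThan_Suc_shift R_def del: prod.lessThan_Suc)
    moreover have "(\<Prod>i<Suc n. 1 + ?q * ?q ^ i) = R (Suc n)"
      by (simp only: R_def power_Suc)
    ultimately have "R (Suc n) * (2 * R n) = S (Suc n)"
      by (simp only:)
    then show ?thesis
      by (simp only: ac_simps)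
  qed
  have S_lim: "(\<lambda>n. euler_fps k * S n) \<longlonglongrightarrow> ?\<theta>"
    unfolding S_def
    by (rule tendsto_theta_series[where c = "\<lambda>_. 1" and e = "\<lambda>t. k * tri t", OF k])
       (rule growth_scale[where e = tri, OF abs_le_tri k])
  have lim1: "(\<lambda>n. (euler_fps k * S (Suc n)) * (qpoch ?q (Suc n) * qpoch ?q n)) \<longlonglongrightarrow>
      ?\<theta> * (euler_fps k * euler_fps k)"
    by (intro tendsto_mult_fps LIMSEQ_Suc[OF S_lim] LIMSEQ_Suc[OF tendsto_qpoch_euler[OF k]]
        tendsto_qpoch_euler[OF k])
  have eq: "(euler_fps k * S (Suc n)) * (qpoch ?q (Suc n) * qpoch ?q n) =
      (euler_fps k * 2) * (qpoch ?Q (Suc n) * qpoch ?Q n)" for n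
    unfolding S Q qpoch_square [symmetric] R_def by (simp only: ac_simps)
  have lim2: "(\<lambda>n. (euler_fps k * 2) * (qpoch ?Q (Suc n) * qpoch ?Q n)) \<longlonglongrightarrow>
      (euler_fps k * 2) * (euler_fps (2 * k) * euler_fps (2 * k))"
    by (intro tendsto_mult_fps tendsto_const LIMSEQ_Suc[OF tendsto_qpoch_euler[OF k2]]
        tendsto_qpoch_euler[OF k2])
  have "?\<theta> * (euler_fps k * euler_fps k) =
      (euler_fps k * 2) * (euler_fps (2 * k) * euler_fps (2 * k))"
    using lim1 lim2 unfolding eq by (rule LIMSEQ_unique)
  then have "euler_fps k * (2 * euler_fps (2 * k) ^ 2) = euler_fps k * (euler_fps k * ?\<theta>)"
    by (simp only: power2_eq_square ac_simps)
  then show ?thesis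
    using euler_fps_nonzero[of k] k by simp
qed

lemma qbinomial_fps_const: "qbinomial (fps_const q) n j = fps_const (qbinomial q n j)"
proof (induction q n j rule: qbinomial.induct)
  case (3 q n k)
  then show ?case
    by (simp add: fps_const_power fps_const_mult [symmetric] fps_const_add [symmetric]
          del: fps_const_mult fps_const_add power_Suc)
qed simp_all

lemma fps_nth_0_prod: "fps_nth (\<Prod>i\<in>I. f i) 0 = (\<Prod>i\<in>I. fps_nth (f i) 0)"
  by (induction I rule: infinite_finite_induct) simp_all

text \<open>
  Jacobi's identity is the derivative of the triple product at a zero. Put \<open>A = - q (1 + \<epsilon>)\<close> and
  \<open>B = - 1 / (1 + \<epsilon>)\<close>, so that the base \<open>A B = q\<close> is free of \<open>\<epsilon>\<close> and the term with index \<open>t\<close> is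
  \<open>(-1)\<^sup>t q\<^bsup>t (t + 1) / 2\<^esup> (1 + \<epsilon>)\<^sup>t\<close>. The factor \<open>1 + B = \<epsilon> - \<dots>\<close> vanishes at \<open>\<epsilon> = 0\<close>, hence the
  coefficient of \<open>\<epsilon>\<close> on the left is the product of the other factors at \<open>\<epsilon> = 0\<close>, and the constant
  coefficient is 0. On the right these two coefficients carry the weights \<open>t\<close> and 1; twice
  the first plus the second gives \<open>2 t + 1\<close>.
\<close>
lemma finite_jacobi:
  fixes q :: "'a::comm_ring_1"
  shows "(\<Sum>j\<le>Suc n + Suc n. qbinomial q (Suc n + Suc n) j *
      (of_int (jacobi_weight (int j - int (Suc n))) *
        q ^ tri (int j - int (Suc n)))) =
    2 * qpoch q (Suc n) * qpoch q n"
proof -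
  \<comment> \<open>the outer variable \<open>fps_X\<close> is \<open>\<epsilon>\<close>, and \<open>w\<close> is the inverse of \<open>1 + \<epsilon>\<close>\<close>
  let ?z = "1 + fps_X :: 'a fps" and ?N = "Suc n"
  define w :: "'a fps" where "w = Abs_fps (\<lambda>i. (- 1) ^ i)"
  define A B where "A = - (fps_const q * ?z)" and "B = - w"
  have zw: "?z * w = 1"
  proof (rule fps_ext)
    fix i show "fps_nth (?z * w) i = fps_nth 1 i"
      by (cases i) (simp_all add: w_def distrib_right)
  qed
  have AB: "A * B = fps_const q"
    using zw by (simp add: A_def B_def mult.assoc)
  define G where "G t = A ^ tri t * B ^ tri (- t)" for t
  have sgn: "(- 1 :: 'a) ^ tri t * (- 1) ^ tri (- t) = of_int (alt_sign t)" for t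
    by (simp add: power_add [symmetric] tri_add_tri_uminus alt_sign_power [symmetric])
  have A0: "fps_nth (A ^ m) 0 = (- 1) ^ m * q ^ m" and B0: "fps_nth (B ^ m) 0 = (- 1) ^ m"
    and A1: "fps_nth (A ^ m) (Suc 0) = of_nat m * ((- 1) ^ m * q ^ m)"
    and B1: "fps_nth (B ^ m) (Suc 0) = - of_nat m * (- 1) ^ m" for m
  proof (induction m)
    case (Suc m)
    { case 1 show ?case using Suc by (simp add: A_def) }
    { case 2 show ?case using Suc by (simp add: B_def w_def) }
    { case 3 show ?case using Suc by (simp add: A_def algebra_simps) }
    { case 4 show ?case using Suc by (simp add: B_def w_def algebra_simps) }
  qed simp_all
  have G0: "fps_nth (G t) 0 = of_int (alt_sign t) * q ^ tri t" for t
    by (simp add: G_def A0 B0 sgn [symmetric] ac_simps)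
  have G1: "fps_nth (G t) (Suc 0) = of_int (t * alt_sign t) * q ^ tri t" for t
  proof -
    have "fps_nth (G t) (Suc 0) =
        (of_nat (tri t) - of_nat (tri (- t))) * ((- 1) ^ tri t * (- 1) ^ tri (- t)) * q ^ tri t"
      by (simp add: G_def A0 B0 A1 B1 algebra_simps)
    also have "of_nat (tri t) - of_nat (tri (- t)) = (of_int t :: 'a)"
    proof -
      have "t = int (tri t) - int (tri (- t))"
        using tri_uminus[of t] by simp
      then have "(of_int t :: 'a) = of_int (int (tri t) - int (tri (- t)))"
        by (rule arg_cong)
      then show ?thesis
        by simp
    qed
    finally show ?thesis
      by (simp add: sgn)
  qed
  define P where "P = (\<Prod>i<?N. 1 + A * fps_const q ^ i) * (\<Prod>i<n. 1 + B * fps_const q ^ Suc i)"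
  have sum: "(1 + B) * P = (\<Sum>j\<le>?N + ?N. fps_const (qbinomial q (?N + ?N) j) * G (int j - int ?N))"
  proof -
    have "(\<Prod>i<?N. 1 + B * fps_const q ^ i) = (1 + B) * (\<Prod>i<n. 1 + B * fps_const q ^ Suc i)"
      by (simp add: prod.lessThan_Suc_shift del: prod.lessThan_Suc)
    then have "(1 + B) * P = (\<Prod>i<?N. 1 + A * fps_const q ^ i) * (\<Prod>i<?N. 1 + B * fps_const q ^ i)"
      by (simp only: P_def ac_simps)
    also have "\<dots> = (\<Sum>j\<le>?N + ?N. fps_const (qbinomial q (?N + ?N) j) * G (int j - int ?N))"
      using finite_triple_product[where A = A and B = B and a = ?N and b = ?N]
      by (simp only: AB G_def qbinomial_fps_const minus_diff_eq)
    finally show ?thesis .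
  qed
  have P0: "fps_nth P 0 = qpoch q ?N * qpoch q n"
    by (simp add: P_def fps_nth_0_prod fps_power_zeroth A_def B_def w_def qpoch_def
          del: prod.lessThan_Suc)
  have "(\<Sum>j\<le>?N + ?N. qbinomial q (?N + ?N) j * fps_nth (G (int j - int ?N)) 0) =
      fps_nth ((1 + B) * P) 0"
    unfolding sum by (simp only: fps_sum_nth fps_mult_left_const_nth)
  also have "\<dots> = 0"
    by (simp add: B_def w_def)
  finally have c0: "(\<Sum>j\<le>?N + ?N. qbinomial q (?N + ?N) j * fps_nth (G (int j - int ?N)) 0) = 0" .
  have "(\<Sum>j\<le>?N + ?N. qbinomial q (?N + ?N) j * fps_nth (G (int j - int ?N)) (Suc 0)) =
      fps_nth ((1 + B) * P) (Suc 0)"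
    unfolding sum by (simp only: fps_sum_nth fps_mult_left_const_nth)
  also have "\<dots> = fps_nth P 0"
    by (simp add: B_def w_def)
  finally have c1: "(\<Sum>j\<le>?N + ?N. qbinomial q (?N + ?N) j * fps_nth (G (int j - int ?N)) (Suc 0)) =
      qpoch q ?N * qpoch q n"
    unfolding P0 .
  have "of_int (jacobi_weight t) * q ^ tri t = 2 * fps_nth (G t) (Suc 0) + fps_nth (G t) 0" for t
    unfolding G0 G1 jacobi_weight_def by (simp add: algebra_simps)
  then have "(\<Sum>j\<le>?N + ?N. qbinomial q (?N + ?N) j *
      (of_int (jacobi_weight (int j - int ?N)) * q ^ tri (int j - int ?N))) =
      2 * (\<Sum>j\<le>?N + ?N. qbinomial q (?N + ?N) j * fps_nth (G (int j - int ?N)) (Suc 0)) +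
      (\<Sum>j\<le>?N + ?N. qbinomial q (?N + ?N) j * fps_nth (G (int j - int ?N)) 0)"
    by (simp only: distrib_left sum.distrib sum_distrib_left mult.left_commute[of 2])
  then show ?thesis
    by (simp only: c0 c1 add_0_right mult.assoc)
qed

theorem jacobi_cube_series:
  assumes k: "k > 0"
  shows "2 * euler_fps k ^ 3 = theta_series jacobi_weight (\<lambda>t. k * tri t)"
proof -
  let ?q = "fps_X ^ k :: int fps"
  let ?\<theta> = "theta_series jacobi_weight (\<lambda>t. k * tri t)"
  define S where "S n = (\<Sum>j\<le>n + n. qbinomial ?q (n + n) j *
      (fps_const (jacobi_weight (int j - int n)) * fps_X ^ (k * tri (int j - int n))))" for n
  have S: "S (Suc n) = 2 * qpoch ?q (Suc n) * qpoch ?q n" for n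
    unfolding S_def finite_jacobi [symmetric] power_mult
    by (simp only: fps_of_int [symmetric] of_int_eq_id id_apply)
  have "(\<lambda>n. euler_fps k * S n) \<longlonglongrightarrow> ?\<theta>"
    unfolding S_def
    by (rule tendsto_theta_series[where c = jacobi_weight and e = "\<lambda>t. k * tri t", OF k])
       (rule growth_scale[where e = tri, OF abs_le_tri k])
  then have "(\<lambda>n. euler_fps k * S (Suc n)) \<longlonglongrightarrow> ?\<theta>"
    by (rule LIMSEQ_Suc)
  moreover have "(\<lambda>n. euler_fps k * (2 * qpoch ?q (Suc n) * qpoch ?q n)) \<longlonglongrightarrow>
      euler_fps k * (2 * euler_fps k * euler_fps k)"
    by (intro tendsto_mult_fps tendsto_const LIMSEQ_Suc[OF tendsto_qpoch_euler[OF k]]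
        tendsto_qpoch_euler[OF k])
  ultimately have "?\<theta> = euler_fps k * (2 * euler_fps k * euler_fps k)"
    unfolding S by (rule LIMSEQ_unique)
  then show ?thesis
    by (simp only: power3_eq_cube ac_simps)
qed

section \<open>The generating function as a quaternary theta series\<close>

definition weight :: "(int \<times> int) \<times> (int \<times> int) \<Rightarrow> int" where
  "weight = (\<lambda>((s, t), (u, v)). alt_sign s * jacobi_weight t * jacobi_weight v)"

text \<open>
  The generating function has the scales \<open>a = 1\<close>, \<open>b = 5\<close>; dissection exchanges them.
\<close>
definition exponent :: "nat \<Rightarrow> nat \<Rightarrow> (int \<times> int) \<times> (int \<times> int) \<Rightarrow> nat" where
  "exponent a b = (\<lambda>((s, t), (u, v)). a * (nat (s\<^sup>2) + tri t) + b * (tri u + 2 * tri v))"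

text \<open>
  The factor 8 collects the factors 2 of the two identities of Jacobi, for \<open>f\<^sub>1\<^sup>3\<close> and \<open>f\<^sub>1\<^sub>0\<^sup>3\<close>, and of
  the identity of Gauss for \<open>f\<^sub>1\<^sub>0\<^sup>2\<close>. It is harmless, being prime to 5.
\<close>
lemma Tstar_theta_series: "8 * Abs_fps Tstar = theta_series weight (exponent 1 5)"
proof -
  define \<phi> J \<psi> K where "\<phi> = theta_series alt_sign (\<lambda>s. 1 * nat (s\<^sup>2))"
    and "J = theta_series jacobi_weight (\<lambda>t. 1 * tri t)"
    and "\<psi> = theta_series (\<lambda>_. 1) (\<lambda>t. 5 * tri t)"
    and "K = theta_series jacobi_weight (\<lambda>t. 10 * tri t)"
  have "euler_fps 1 ^ 2 = euler_fps 2 * \<phi>"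
    using gauss_square_series[of 1] by (simp add: \<phi>_def)
  moreover have "2 * euler_fps 1 ^ 3 = J"
    using jacobi_cube_series[of 1] by (simp add: J_def)
  moreover have "2 * euler_fps 10 ^ 2 = euler_fps 5 * \<psi>"
    using gauss_triangular_series[of 5] by (simp add: \<psi>_def)
  moreover have "2 * euler_fps 10 ^ 3 = K"
    using jacobi_cube_series[of 10] by (simp add: K_def)
  ultimately have "(euler_fps 1 ^ 2) * (2 * euler_fps 1 ^ 3) *
      ((2 * euler_fps 10 ^ 2) * (2 * euler_fps 10 ^ 3)) =
      (euler_fps 2 * \<phi>) * J * ((euler_fps 5 * \<psi>) * K)"
    by (simp only:)
  moreover have "(x ^ 2) * (2 * x ^ 3) * ((2 * y ^ 2) * (2 * y ^ 3)) = 8 * (x ^ 5 * y ^ 5)"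
    for x y :: "int fps"
    by (simp add: numeral_eq_Suc algebra_simps)
  ultimately have "8 * (Abs_fps Tstar * (euler_fps 2 * euler_fps 5)) =
      (euler_fps 2 * \<phi>) * J * ((euler_fps 5 * \<psi>) * K)"
    unfolding Tstar_generating_function by (simp only:)
  then have "(euler_fps 2 * euler_fps 5) * (8 * Abs_fps Tstar) =
      (euler_fps 2 * euler_fps 5) * ((\<phi> * J) * (\<psi> * K))"
    by (simp only: ac_simps)
  then have "8 * Abs_fps Tstar = (\<phi> * J) * (\<psi> * K)"
    using euler_fps_nonzero[of 2] euler_fps_nonzero[of 5] by simp
  also have "\<dots> = theta_series weight (exponent 1 5)"
  proof -
    have tri: "finite {t. k * tri t = n}" if "k > 0" for k n
      by (rule finite_fibre_growth) (rule growth_scale[where e = tri, OF abs_le_tri that])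
    have square: "finite {s. 1 * nat (s\<^sup>2) = n}" for n
      by (rule finite_fibre_growth)
         (rule growth_scale[where e = "\<lambda>s. nat (s\<^sup>2)", OF abs_le_square zero_less_one])
    have "\<phi> * J = theta_series (\<lambda>(s, t). alt_sign s * jacobi_weight t)
        (\<lambda>(s, t). 1 * nat (s\<^sup>2) + 1 * tri t)"
      unfolding \<phi>_def J_def by (rule theta_series_mult[OF square tri[OF zero_less_one]])
    moreover have "\<psi> * K = theta_series (\<lambda>(u, v). 1 * jacobi_weight v)
        (\<lambda>(u, v). 5 * tri u + 10 * tri v)"
      unfolding \<psi>_def K_def by (rule theta_series_mult) (rule tri; simp)+
    ultimately have "(\<phi> * J) * (\<psi> * K) = theta_series
        (\<lambda>(p, q). (case p of (s, t) \<Rightarrow> alt_sign s * jacobi_weight t) *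
           (case q of (u, v) \<Rightarrow> 1 * jacobi_weight v))
        (\<lambda>(p, q). (case p of (s, t) \<Rightarrow> 1 * nat (s\<^sup>2) + 1 * tri t) +
           (case q of (u, v) \<Rightarrow> 5 * tri u + 10 * tri v))"
      using theta_series_mult[OF finite_fibre_pair[OF square tri[OF zero_less_one]]
          finite_fibre_pair[where e = "\<lambda>u. 5 * tri u" and e' = "\<lambda>v. 10 * tri v"]] tri by simp
    also have "\<dots> = theta_series weight (exponent 1 5)"
      by (rule arg_cong2[where f = theta_series]) (auto simp: weight_def exponent_def)
    finally show ?thesis .
  qed
  finally show ?thesis .
qed

section \<open>Dissection modulo 5\<close>

lemma mod_5_cases: "x mod 5 \<in> {0, 1, 2, 3, 4}" for x :: int
  by auto

lemma cong_mod_5: "[x = x mod 5] (mod 5)" for x :: int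
  by (simp add: cong_def)

text \<open>
  With \<open>N\<close> the sum in question, \<open>8 N + 1 = 8 s\<^sup>2 + (2 t + 1)\<^sup>2\<close> is divisible by 5, and \<open>- 8\<close> is not a square
  modulo 5, so \<open>s\<close> and \<open>2 t + 1\<close> are divisible by 5. As there are only 25 pairs of residues,
  the proof inspects them.
\<close>
lemma square_add_tri_mod_5:
  assumes "(nat (s\<^sup>2) + tri t) mod 5 = 3"
  shows "\<exists>s' t'. s = 5 * s' \<and> t = 5 * t' + 2"
proof -
  have aux: "2 * int k mod 5 = 1" if "k mod 5 = 3" for k
    using that by presburger
  have "2 * s\<^sup>2 + t * (t + 1) = 2 * int (nat (s\<^sup>2) + tri t)"
    using two_tri[of t] by simp
  also have "\<dots> mod 5 = 1"
    by (rule aux) fact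
  finally have "(2 * s\<^sup>2 + t * (t + 1)) mod 5 = 1" .
  moreover have "(2 * s\<^sup>2 + t * (t + 1)) mod 5 =
      (2 * (s mod 5)\<^sup>2 + (t mod 5) * (t mod 5 + 1)) mod 5"
    unfolding cong_def [symmetric] power2_eq_square
    by (intro cong_add cong_mult cong_mod_5 cong_refl)
  ultimately have "s mod 5 = 0 \<and> t mod 5 = 2"
    using mod_5_cases[of s] mod_5_cases[of t] by auto
  then have "s = 5 * (s div 5) \<and> t = 5 * (t div 5) + 2"
    by presburger
  then show ?thesis
    by blast
qed

text \<open>
  Here \<open>8 N + 3 = (2 u + 1)\<^sup>2 + 2 (2 v + 1)\<^sup>2\<close> is divisible by 5, and \<open>- 2\<close> is not a square modulo 5.
\<close>
lemma tri_add_double_tri_mod_5: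
  assumes "(tri u + 2 * tri v) mod 5 = 4"
  shows "\<exists>u' v'. u = 5 * u' + 2 \<and> v = 5 * v' + 2"
proof -
  have aux: "2 * int k mod 5 = 3" if "k mod 5 = 4" for k
    using that by presburger
  have "u * (u + 1) + 2 * (v * (v + 1)) = 2 * int (tri u + 2 * tri v)"
    using two_tri[of u] two_tri[of v] by simp
  also have "\<dots> mod 5 = 3"
    by (rule aux) fact
  finally have "(u * (u + 1) + 2 * (v * (v + 1))) mod 5 = 3" .
  moreover have "(u * (u + 1) + 2 * (v * (v + 1))) mod 5 =
      ((u mod 5) * (u mod 5 + 1) + 2 * ((v mod 5) * (v mod 5 + 1))) mod 5"
    unfolding cong_def [symmetric] power2_eq_square
    by (intro cong_add cong_mult cong_mod_5 cong_refl)
  ultimately have "u mod 5 = 2 \<and> v mod 5 = 2"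
    using mod_5_cases[of u] mod_5_cases[of v] by auto
  then have "u = 5 * (u div 5) + 2 \<and> v = 5 * (v div 5) + 2"
    by presburger
  then show ?thesis
    by blast
qed

lemma tri_5: "tri (5 * t + 2) = 25 * tri t + 3"
  using two_tri[of "5 * t + 2"] two_tri[of t] by (simp add: algebra_simps)

lemma alt_sign_5: "alt_sign (5 * t) = alt_sign t"
  by (simp add: alt_sign_def)

lemma jacobi_weight_5: "jacobi_weight (5 * t + 2) = 5 * jacobi_weight t"
  by (simp add: jacobi_weight_def alt_sign_def)

text \<open>
  The substitution \<open>s = 5 s'\<close>, \<open>2 t + 1 = 5 (2 t' + 1)\<close> multiplies \<open>s\<^sup>2 + tri t\<close> by 25, up to the constant 3,
  whereas the other two indices already carry the factor 5. Dividing by 5 leaves the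
  scales 5 and 1.
\<close>
lemma theta_series_coeff_3_mod_5:
  "fps_nth (theta_series weight (exponent 1 5)) (5 * n + 3) =
   5 * fps_nth (theta_series weight (exponent 5 1)) n"
proof (rule theta_series_dissection)
  let ?g = "\<lambda>((s, t), q). ((5 * s, 5 * t + 2), q) :: (int \<times> int) \<times> (int \<times> int)"
  show "inj ?g"
    by (auto simp: inj_def)
  show "p \<in> range ?g" if "exponent 1 5 p mod 5 = 3" for p
  proof -
    obtain s t u v where p: "p = ((s, t), (u, v))"
      by (metis prod.collapse)
    have "(nat (s\<^sup>2) + tri t) mod 5 = 3"
      using that by (simp only: p exponent_def prod.case mult_1_left mod_mult_self2)
    then obtain s' t' where "s = 5 * s'" "t = 5 * t' + 2"
      using square_add_tri_mod_5 by blast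
    then have "p = ?g ((s', t'), (u, v))"
      by (simp add: p)
    then show ?thesis
      by (rule range_eqI)
  qed
  show "exponent 1 5 (?g p) = 5 * exponent 5 1 p + 3" for p
    by (cases p) (auto simp: exponent_def tri_5 power_mult_distrib nat_mult_distrib split: prod.splits)
  show "weight (?g p) = 5 * weight p" for p
  proof -
    obtain s t u v where p: "p = ((s, t), (u, v))"
      by (metis prod.collapse)
    show ?thesis
      unfolding p weight_def prod.case alt_sign_5 jacobi_weight_5 by (simp only: ac_simps)
  qed
qed simp

text \<open>
  Now the other pair of indices is divided by 5. The constant 9 from the two triangular numbers is
  \<open>5 * 1 + 4\<close>, hence the shift by 1 in the exponent on the right.
\<close>
lemma theta_series_coeff_4_mod_5:
  "fps_nth (theta_series weight (exponent 5 1)) (5 * n + 4) =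
   5 * fps_nth (theta_series weight (\<lambda>p. exponent 1 5 p + 1)) n"
proof (rule theta_series_dissection)
  let ?g = "\<lambda>(p, (u, v)). (p, (5 * u + 2, 5 * v + 2)) :: (int \<times> int) \<times> (int \<times> int)"
  show "inj ?g"
    by (auto simp: inj_def)
  show "p \<in> range ?g" if "exponent 5 1 p mod 5 = 4" for p
  proof -
    obtain s t u v where p: "p = ((s, t), (u, v))"
      by (metis prod.collapse)
    have "(tri u + 2 * tri v) mod 5 = 4"
      using that by (simp only: p exponent_def prod.case mult_1_left mod_mult_self4)
    then obtain u' v' where "u = 5 * u' + 2" "v = 5 * v' + 2"
      using tri_add_double_tri_mod_5 by blast
    then have "p = ?g ((s, t), (u', v'))"
      by (simp add: p)
    then show ?thesis
      by (rule range_eqI)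
  qed
  show "exponent 5 1 (?g p) = 5 * (exponent 1 5 p + 1) + 4" for p
    by (cases p) (auto simp: exponent_def tri_5 split: prod.splits)
  show "weight (?g p) = 5 * weight p" for p
  proof -
    obtain s t u v where p: "p = ((s, t), (u, v))"
      by (metis prod.collapse)
    show ?thesis
      unfolding p weight_def prod.case alt_sign_5 jacobi_weight_5 by (simp only: ac_simps)
  qed
qed simp

lemma coeff_Tstar: "fps_nth (theta_series weight (exponent 1 5)) n = 8 * Tstar n"
  unfolding Tstar_theta_series [symmetric] by (simp add: numeral_fps_const)

lemma theta_series_Suc: "fps_nth (theta_series c (\<lambda>i. e i + 1)) (Suc n) = fps_nth (theta_series c e) n"
  by (simp add: theta_series_def)

section \<open>Congruences modulo powers of 5\<close>

lemma five_dvd_Tstar: "5 dvd Tstar (5 * n + 3)"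
proof -
  have "5 dvd 8 * Tstar (5 * n + 3)"
    unfolding coeff_Tstar [symmetric] theta_series_coeff_3_mod_5 by simp
  then show ?thesis
    by presburger
qed

lemma Tstar_25_dvd: "25 dvd Tstar (25 * n + 23)"
proof -
  have "fps_nth (theta_series weight (exponent 1 5)) (5 * (5 * n + 4) + 3) =
      25 * fps_nth (theta_series weight (\<lambda>p. exponent 1 5 p + 1)) n"
    unfolding theta_series_coeff_3_mod_5 theta_series_coeff_4_mod_5 by simp
  moreover have "5 * (5 * n + 4) + 3 = 25 * n + 23"
    by simp
  ultimately have "25 dvd 8 * Tstar (25 * n + 23)"
    by (simp only: coeff_Tstar dvd_triv_left)
  then show ?thesis
    by presburger
qed

text \<open>
  For \<open>Suc n\<close> the shift in \<open>theta_series_coeff_4_mod_5\<close> cancels, so that the same theta series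
  appears on both sides. The case left out by this, \<open>n = 0\<close>, is the reason why \<open>Tstar_25_dvd\<close> is
  stated separately.
\<close>
lemma Tstar_25: "Tstar (25 * n + 48) = 25 * Tstar n"
proof -
  have "fps_nth (theta_series weight (exponent 1 5)) (5 * (5 * Suc n + 4) + 3) =
      25 * fps_nth (theta_series weight (exponent 1 5)) n"
    unfolding theta_series_coeff_3_mod_5 theta_series_coeff_4_mod_5 theta_series_Suc by simp
  moreover have "5 * (5 * Suc n + 4) + 3 = 25 * n + 48"
    by simp
  ultimately have "8 * Tstar (25 * n + 48) = 25 * (8 * Tstar n)"
    by (simp only: coeff_Tstar)
  then show ?thesis
    by simp
qed

text \<open>
  In terms of \<open>m = 5\<^bsup>Suc a\<^esup> (n + 1)\<close> the relation \<open>Tstar_25\<close> leads from the index \<open>m - 2\<close> to the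
  index \<open>25 m - 2\<close>, so the exponents 1 and 2 suffice as base cases.
\<close>
lemma Tstar_dvd: "5 ^ Suc a dvd Tstar (5 ^ Suc a * (n + 1) - 2)"
proof (induction a rule: induct_nat_012)
  case 0
  have "5 ^ Suc 0 * (n + 1) - 2 = 5 * n + 3"
    by simp
  then show ?case
    using five_dvd_Tstar[of n] by (simp only: power_one_right One_nat_def [symmetric])
next
  case 1
  have "5 ^ Suc (Suc 0) * (n + 1) - 2 = 25 * n + 23" and "(5::int) ^ Suc (Suc 0) = 25"
    by simp_all
  then show ?case
    using Tstar_25_dvd[of n] by (simp only:)
next
  case (ge2 a)
  define M where "M = 5 ^ Suc a * (n + 1) - 2"
  have "(5::nat) ^ Suc a * (n + 1) \<ge> 5 * 1"
    by (intro mult_le_mono) simp_all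
  moreover have "(5::nat) ^ Suc (Suc (Suc a)) * (n + 1) = 25 * (5 ^ Suc a * (n + 1))"
    by simp
  ultimately have "5 ^ Suc (Suc (Suc a)) * (n + 1) - 2 = 25 * M + 48"
    unfolding M_def by linarith
  moreover have "25 * 5 ^ Suc a dvd 25 * Tstar M"
    using ge2(1) unfolding M_def by (rule mult_dvd_mono[OF dvd_refl])
  ultimately show ?case
    by (simp only: Tstar_25) simp
qed

theorem corollary3:
  fixes n \<alpha> :: nat
  assumes "\<alpha> \<ge> 1"
  shows "[Tstar (5 ^ \<alpha> * n + 5 ^ \<alpha> - 2) = 0] (mod 5 ^ \<alpha>)"
proof -
  obtain a where "\<alpha> = Suc a"
    using assms by (cases \<alpha>) auto
  then have "5 ^ \<alpha> * n + 5 ^ \<alpha> - 2 = 5 ^ Suc a * (n + 1) - 2"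
    by simp
  then show ?thesis
    using Tstar_dvd[of a n] \<open>\<alpha> = Suc a\<close> by (simp only: cong_0_iff)
qed

end
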